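(* Let $f:\mathbb{N}\to\mathbb{N}$ be an increasing function with $f(0)>0$. For every type $\tau$ (finite multiset of natural numbers) and every $t\in\mathbb{N}$, \[ L_{\tau}(t)\;\leq\;\max_{k\in\tau}\bigl\{1+L_{\tau_{\langle k,t\rangle}}(t+1)\bigr\}, \] with the convention $\max\emptyset=0$.
   Context: A type is a finite multiset $\tau$ of natural numbers. For $\tau=\{k_i\mid i\in I\}$, $\mathbb{N}^\tau$ denotes the disjoint union $\sum_{i\in I}\mathbb{N}^{k_i}$ (so $\mathbb{N}^{\{k\}}=\mathbb{N}^k$, $\mathbb{N}^\emptyset=\emptyset$, and $\mathbb{N}^0=\{\langle\rangle\}$), ordered by the sum of the product orderings: $x\le y$ iff $x,y$ lie in the same summand $\mathbb{N}^{k_i}$ and $x[j]\le y[j]$ for all coordinates $j$. Types are added and scaled as multisets: $(\tau_1+\tau_2)(k)=\tau_1(k)+\tau_2(k)$, $(p\times\tau)(k)=p\cdot\tau(k)$, and $\tau-\tau_1$ is defined when $\tau_1\subseteq\tau$. The norm $\|x\|_\infty$ is the maximum coordinate of $x$ (0 for the empty tuple). A sequence $x_0,\dots,x_l$ over $\mathbb{N}^\tau$ is $t$-controlled if $\|x_i\|_\infty<f(i+t)$ for all $i$; it is bad if there are no indices $i<j$ with $x_i\le x_j$. $L_\tau(t)$ is the maximal length of a $t$-controlled bad sequence over $\mathbb{N}^\tau$. Let $N_k(t)=k\cdot(f(t)-1)$, and for $k\in\tau$ let $\tau_{\langle k,t\rangle}=\tau-\{k\}+N_k(t)\times\{k-1\}$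 (for $k=0$ this is $\tau-\{0\}$). *)

theory Defs
  imports Main "HOL-Library.Multiset"
begin

text \<open>
  For a multiset \<open>\<tau>\<close> of naturals, \<open>carrier_of \<tau>\<close> is the disjoint union of the \<open>\<nat>\<^sup>k\<close> for \<open>k\<close>
  in \<open>\<tau>\<close>, counted with multiplicity. A point is \<open>((k, c), v)\<close>: the summand is the
  \<open>c\<close>-th copy (\<open>c < count \<tau> k\<close>) of \<open>\<nat>\<^sup>k\<close>, and the \<open>k\<close>-tuple is the list \<open>v\<close>.
\<close>

type_synonym point = "(nat \<times> nat) \<times> nat list"

definition carrier_of :: "nat multiset \<Rightarrow> point set" where
  "carrier_of \<tau> = {((k, c), v) | k c v. c < count \<tau> k \<and> length v = k}"

definition point_le :: "point \<Rightarrow> point \<Rightarrow> bool" where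
  "point_le x y \<longleftrightarrow> fst x = fst y \<and> list_all2 (\<le>) (snd x) (snd y)"

definition norm_inf :: "point \<Rightarrow> nat" where
  "norm_inf x = Max (insert 0 (set (snd x)))"

definition controlled :: "(nat \<Rightarrow> nat) \<Rightarrow> nat \<Rightarrow> point list \<Rightarrow> bool" where
  "controlled f t xs \<longleftrightarrow> (\<forall>i < length xs. norm_inf (xs ! i) < f (i + t))"

definition bad :: "point list \<Rightarrow> bool" where
  "bad xs \<longleftrightarrow> \<not> (\<exists>i j. i < j \<and> j < length xs \<and> point_le (xs ! i) (xs ! j))"

text \<open>
  The empty sequence is admitted, so that \<open>L f {#} t = 0\<close>. The set of lengths is always
  finite (Dickson's lemma and Koenig's lemma), so \<open>Max\<close> is a genuine maximum.
\<close>

definition L :: "(nat \<Rightarrow> nat) \<Rightarrow> nat multiset \<Rightarrow> nat \<Rightarrow> nat" where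
  "L f \<tau> t = Max {length xs | xs. set xs \<subseteq> carrier_of \<tau> \<and> controlled f t xs \<and> bad xs}"

definition N :: "(nat \<Rightarrow> nat) \<Rightarrow> nat \<Rightarrow> nat \<Rightarrow> nat" where
  "N f k t = k * (f t - 1)"

text \<open>For \<open>k = 0\<close> the scaled summand vanishes, so the truncated \<open>k - 1\<close> is harmless.\<close>

definition derived_type :: "(nat \<Rightarrow> nat) \<Rightarrow> nat multiset \<Rightarrow> nat \<Rightarrow> nat \<Rightarrow> nat multiset" where
  "derived_type f \<tau> k t = \<tau> - {#k#} + repeat_mset (N f k t) {#k - 1#}"

end

theory Submission
  imports Defs
begin

text \<open>
  Let \<open>x\<close> be the first element of a controlled bad sequence, in a summand \<open>\<nat>\<^sup>k\<close>. Every later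
  \<open>y\<close> in that summand has a coordinate \<open>y[j] < x[j] < f t\<close>. The pair \<open>(j, y[j])\<close> takes at most
  \<open>k \<cdot> (f t - 1)\<close> values, so deleting the coordinate \<open>j\<close> and recording the pair in the copy of
  \<open>\<nat>\<^bsup>k-1\<^esup>\<close> reflects the ordering and maps the rest of the sequence into the derived type. The
  derived type is smaller in the multiset ordering, so the same step also yields, by well-founded
  induction, that the lengths are bounded.
\<close>

section \<open>Deleting a coordinate\<close>

definition remove_nth :: "nat \<Rightarrow> 'a list \<Rightarrow> 'a list" where
  "remove_nth j w = take j w @ drop (Suc j) w"

lemma length_remove_nth: "j < length w \<Longrightarrow> length (remove_nth j w) = length w - 1"
  by (simp add: remove_nth_def)

lemma set_remove_nth_subset: "set (remove_nth j w) \<subseteq> set w"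
  by (auto simp: remove_nth_def dest: in_set_takeD in_set_dropD)

lemma list_all2_remove_nthD:
  assumes "list_all2 P (remove_nth j u) (remove_nth j w)" "P (u ! j) (w ! j)"
    and "j < length u" "j < length w"
  shows "list_all2 P u w"
proof -
  have "list_all2 P (take j u) (take j w) \<and> list_all2 P (drop (Suc j) u) (drop (Suc j) w)"
    using assms(1,3,4) by (simp add: remove_nth_def list_all2_append)
  then have "list_all2 P (take j u @ u ! j # drop (Suc j) u) (take j w @ w ! j # drop (Suc j) w)"
    using assms(2) by (intro list_all2_appendI) auto
  then show ?thesis
    using assms(3,4) by (simp add: id_take_nth_drop[symmetric])
qed

text \<open>The choice may be arbitrary: the copy number will record the chosen coordinate, so
  shortened tuples are compared only when their choices agree.\<close>

definition drop_index :: "nat list \<Rightarrow> nat list \<Rightarrow> nat" where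
  "drop_index v w = (SOME j. j < length v \<and> w ! j < v ! j)"

lemma drop_index:
  assumes "\<not> list_all2 (\<le>) v w" "length v = length w"
  shows "drop_index v w < length v" "w ! drop_index v w < v ! drop_index v w"
proof -
  have "\<exists>j. j < length v \<and> w ! j < v ! j"
    using assms by (auto simp: list_all2_conv_all_nth not_le)
  from someI_ex[OF this] show "drop_index v w < length v" "w ! drop_index v w < v ! drop_index v w"
    by (simp_all add: drop_index_def)
qed

section \<open>The map into the derived type\<close>

text \<open>
  The copies of \<open>\<nat>\<^bsup>k-1\<^esup>\<close> beyond those of \<open>\<tau>\<close> are numbered by \<open>j \<cdot> (f t - 1) + w[j]\<close>. Copies of
  \<open>\<nat>\<^sup>k\<close> after the removed copy \<open>c\<close> are shifted down.
\<close>

definition residual_map :: "nat multiset \<Rightarrow> nat \<Rightarrow> point \<Rightarrow> point \<Rightarrow> point" where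
  "residual_map \<tau> b x y = (case (x, y) of (((k, c), v), ((m, d), w)) \<Rightarrow>
     if m \<noteq> k then y
     else if d = c then
       let j = drop_index v w in ((k - 1, count \<tau> (k - 1) + (j * b + w ! j)), remove_nth j w)
     else ((k, if d < c then d else d - 1), w))"

text \<open>For \<open>k = 0\<close> both conditions select \<open>m = 0\<close>, but
  \<open>N f 0 t\<close> is 0, so no copy is added there.\<close>

lemma count_derived_type:
  "count (derived_type f \<tau> k t) m =
     (if m = k then count \<tau> m - 1 else count \<tau> m) + (if m = k - 1 then N f k t else 0)"
  by (auto simp: derived_type_def)

text \<open>This numbers a \<open>k\<close> by \<open>b\<close> grid row by row. With
  \<open>b = f t - 1\<close> the bound is \<open>N f k t\<close>, the number of added
  copies.\<close>

lemma mixed_radix_less: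
  fixes a b i k :: nat
  assumes "i < k" "a < b"
  shows "i * b + a < k * b"
proof -
  have "i * b + a < Suc i * b" using assms by simp
  also have "\<dots> \<le> k * b" using assms by (intro mult_le_mono1) simp
  finally show ?thesis .
qed

text \<open>Division by \<open>b\<close> recovers \<open>i\<close>. Hence the copy number determines
  the deleted coordinate and its value.\<close>

lemma mixed_radix_inj:
  fixes a a' b i i' :: nat
  assumes "i * b + a = i' * b + a'" "a < b" "a' < b"
  shows "i = i' \<and> a = a'"
proof -
  have "(i * b + a) div b = i" "(i' * b + a') div b = i'"
    using assms(2,3) by simp_all
  then have "i = i'" using assms(1) by metis
  then show ?thesis using assms(1) by simp
qed

lemma nth_le_norm_inf: "i < length v \<Longrightarrow> v ! i \<le> norm_inf (p, v)"
  by (simp add: norm_inf_def)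

text \<open>The deleted value moves into the copy number, not into the tuple, so control is
  preserved.\<close>

lemma norm_inf_residual_map: "norm_inf (residual_map \<tau> b x y) \<le> norm_inf y"
proof -
  have "set (snd (residual_map \<tau> b x y)) \<subseteq> set (snd y)"
    by (auto simp: residual_map_def Let_def dest: set_remove_nth_subset[THEN subsetD]
        split: prod.splits if_splits)
  then show ?thesis
    unfolding norm_inf_def by (intro Max_mono) auto
qed

lemma same_summandE:
  assumes "((k, c), v) \<in> carrier_of \<tau>" "norm_inf ((k, c), v) < f t"
    and "((k, c), w) \<in> carrier_of \<tau>" "\<not> point_le ((k, c), v) ((k, c), w)"
  obtains j where "j = drop_index v w" "j < k" "w ! j < f t - 1" "length w = k" "k > 0"
proof -
  have len: "length v = k" "length w = k"
    using assms by (auto simp: carrier_of_def)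
  have nle: "\<not> list_all2 (\<le>) v w"
    using assms by (simp add: point_le_def)
  let ?j = "drop_index v w"
  have j: "?j < k" "w ! ?j < v ! ?j"
    using drop_index[OF nle] len by auto
  moreover have "v ! ?j < f t"
    using nth_le_norm_inf[of ?j v "(k, c)"] assms(2) len j by simp
  \<comment> \<open>Two strict inequalities lead from the entry of \<open>w\<close> through that of
    \<open>v\<close> to \<open>f t\<close>, which gives the bound \<open>f t - 1\<close>.\<close>
  ultimately show thesis
    using that len by simp
qed

lemma residual_map_in_carrier:
  assumes "x \<in> carrier_of \<tau>" "norm_inf x < f t" "y \<in> carrier_of \<tau>" "\<not> point_le x y"
  shows "residual_map \<tau> (f t - 1) x y \<in> carrier_of (derived_type f \<tau> (fst (fst x)) t)"
proof -
  obtain k c v m d w where xy: "x = ((k, c), v)" "y = ((m, d), w)"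
    by (metis prod.exhaust)
  have *: "c < count \<tau> k" "d < count \<tau> m" "length w = m"
    using assms xy by (auto simp: carrier_of_def)
  show ?thesis
  proof (cases "m = k \<and> d = c")
    case True
    then obtain j where j: "j = drop_index v w" "j < k" "w ! j < f t - 1" "length w = k" "k > 0"
      using assms xy same_summandE by metis
    then have "j * (f t - 1) + w ! j < N f k t"
      unfolding N_def by (intro mixed_radix_less)
    with j True show ?thesis
      by (auto simp: xy residual_map_def carrier_of_def count_derived_type length_remove_nth Let_def)
  next
    case False
    \<comment> \<open>If \<open>m = k\<close>, the shift closes the gap left by copy
      \<open>c\<close>, so the new number is below \<open>count \<tau> k - 1\<close>.\<close>
    with * show ?thesis
      by (auto simp: xy residual_map_def carrier_of_def count_derived_type)
  qed
qed

lemma fst_residual_map_same: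
  "fst (residual_map \<tau> b ((k, c), v) ((k, c), w)) =
     (k - 1, count \<tau> (k - 1) + (drop_index v w * b + w ! drop_index v w))"
  by (simp add: residual_map_def Let_def)

text \<open>As \<open>k > 0\<close> separates \<open>k\<close> from \<open>k - 1\<close>, a point
  outside the removed copy lands in dimension \<open>k - 1\<close> only if it was there before, with
  a copy number below \<open>count \<tau> (k - 1)\<close>.\<close>

lemma fst_residual_map_neq:
  assumes "k > 0" "y \<in> carrier_of \<tau>" "fst y \<noteq> (k, c)"
  shows "fst (residual_map \<tau> b ((k, c), v) y) \<noteq> (k - 1, count \<tau> (k - 1) + n)"
  using assms by (auto simp: residual_map_def carrier_of_def Let_def split: if_splits)

text \<open>Old and added copies are disjoint, so comparable images come from points both inside or
  both outside the removed copy. Inside, equal copy numbers mean that the same value was deleted at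
  the same place; outside, tuples are unchanged and the renumbering is injective.\<close>

lemma residual_map_reflects:
  assumes x: "x \<in> carrier_of \<tau>" "norm_inf x < f t"
    and y: "y \<in> carrier_of \<tau>" "\<not> point_le x y"
    and z: "z \<in> carrier_of \<tau>" "\<not> point_le x z"
    and le: "point_le (residual_map \<tau> (f t - 1) x y) (residual_map \<tau> (f t - 1) x z)"
  shows "point_le y z"
proof -
  let ?b = "f t - 1"
  obtain k c v where xe: "x = ((k, c), v)" by (metis prod.exhaust)
  have fst_eq: "fst (residual_map \<tau> ?b x y) = fst (residual_map \<tau> ?b x z)"
    using le by (simp add: point_le_def)
  obtain p u where ye: "y = (p, u)" by (cases y)
  obtain q w where ze: "z = (q, w)" by (cases z)
  consider "p = (k, c)" "q = (k, c)" | "p = (k, c)" "q \<noteq> (k, c)"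
    | "p \<noteq> (k, c)" "q = (k, c)" | "p \<noteq> (k, c)" "q \<noteq> (k, c)" by blast
  then show ?thesis
  proof cases
    case 1
    obtain i where i: "i = drop_index v u" "i < k" "u ! i < ?b" "length u = k"
      using x y 1 xe ye same_summandE by metis
    obtain j where j: "j = drop_index v w" "j < k" "w ! j < ?b" "length w = k"
      using x z 1 xe ze same_summandE by metis
    have "i * ?b + u ! i = j * ?b + w ! j"
      using fst_eq by (simp add: xe ye ze 1 fst_residual_map_same i(1) j(1))
    then have eq: "i = j" "u ! i = w ! j"
      using mixed_radix_inj i(3) j(3) by blast+
    have "list_all2 (\<le>) (remove_nth j u) (remove_nth j w)"
      using le i(1) j(1) eq(1) by (simp add: xe ye ze 1 residual_map_def Let_def point_le_def)
    then show ?thesis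
      using list_all2_remove_nthD[of "(\<le>)" j u w] eq(2) unfolding eq(1)
      by (simp add: point_le_def ye ze 1 i(2,4)[unfolded eq(1)] j(4))
  next
    case 2
    then have "k > 0" using x y xe ye same_summandE by metis
    then have "fst (residual_map \<tau> ?b x z) \<noteq> fst (residual_map \<tau> ?b x y)"
      unfolding xe ye 2(1) fst_residual_map_same
      using z(1) 2(2) by (intro fst_residual_map_neq) (auto simp: ze)
    then show ?thesis using fst_eq by simp
  next
    case 3
    then have "k > 0" using x z xe ze same_summandE by metis
    then have "fst (residual_map \<tau> ?b x y) \<noteq> fst (residual_map \<tau> ?b x z)"
      unfolding xe ze 3(2) fst_residual_map_same
      using y(1) 3(1) by (intro fst_residual_map_neq) (auto simp: ye)
    then show ?thesis using fst_eq by simp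
  next
    case 4
    then show ?thesis
      using le by (cases p; cases q)
        (auto simp: xe ye ze residual_map_def point_le_def split: if_splits)
  qed
qed

section \<open>Lengths of controlled bad sequences\<close>

definition bad_lengths :: "(nat \<Rightarrow> nat) \<Rightarrow> nat multiset \<Rightarrow> nat \<Rightarrow> nat set" where
  "bad_lengths f \<tau> t =
     {length xs | xs. set xs \<subseteq> carrier_of \<tau> \<and> controlled f t xs \<and> bad xs}"

lemma bad_Cons_iff: "bad (x # xs) \<longleftrightarrow> (\<forall>y \<in> set xs. \<not> point_le x y) \<and> bad xs"
proof
  assume b: "bad (x # xs)"
  have "\<not> point_le x y" if "y \<in> set xs" for y
  proof -
    from that obtain j where "j < length xs" "y = xs ! j" by (metis in_set_conv_nth)
    then have "0 < Suc j" "Suc j < length (x # xs)" "(x # xs) ! 0 = x" "(x # xs) ! Suc j = y"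
      by simp_all
    then show ?thesis using b unfolding bad_def by metis
  qed
  moreover have "\<not> point_le (xs ! i) (xs ! j)" if "i < j" "j < length xs" for i j
  proof -
    from that have "Suc i < Suc j" "Suc j < length (x # xs)"
      by simp_all
    then show ?thesis using b unfolding bad_def by (metis nth_Cons_Suc)
  qed
  ultimately show "(\<forall>y \<in> set xs. \<not> point_le x y) \<and> bad xs"
    unfolding bad_def by blast
next
  assume "(\<forall>y \<in> set xs. \<not> point_le x y) \<and> bad xs"
  then show "bad (x # xs)"
    by (auto simp: bad_def nth_Cons split: nat.splits)
qed

lemma bad_map:
  assumes "bad xs"
    and "\<And>y z. y \<in> set xs \<Longrightarrow> z \<in> set xs \<Longrightarrow> point_le (h y) (h z) \<Longrightarrow> point_le y z"
  shows "bad (map h xs)"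
  unfolding bad_def
proof clarify
  fix i j
  assume ij: "i < j" "j < length (map h xs)" "point_le (map h xs ! i) (map h xs ! j)"
  then have "point_le (xs ! i) (xs ! j)"
    by (auto intro!: nth_mem assms(2)[of "xs ! i" "xs ! j"])
  with ij assms(1) show False
    unfolding bad_def by auto
qed

text \<open>Here \<open>k\<close> is the dimension of the summand holding the first element, and
  \<open>n'\<close> is the length of the tail, whose image under \<open>residual_map\<close> is
  again controlled and bad.\<close>

lemma bad_lengths_step:
  assumes "n \<in> bad_lengths f \<tau> t" "n \<noteq> 0"
  obtains k n' where "k \<in># \<tau>" "n' \<in> bad_lengths f (derived_type f \<tau> k t) (t + 1)" "n = Suc n'"
proof -
  obtain x xs where c: "set (x # xs) \<subseteq> carrier_of \<tau>" and ctl: "controlled f t (x # xs)"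
    and bad: "bad (x # xs)" and n: "n = length (x # xs)"
    using assms unfolding bad_lengths_def by (auto simp: neq_Nil_conv)
  let ?h = "residual_map \<tau> (f t - 1) x"
  have x: "x \<in> carrier_of \<tau>" "norm_inf x < f t"
    using c ctl by (auto simp: controlled_def)
  have xs: "y \<in> carrier_of \<tau>" "\<not> point_le x y" if "y \<in> set xs" for y
    using c bad that by (auto simp: bad_Cons_iff)
  \<comment> \<open>Position \<open>i\<close> of the tail is position \<open>Suc i\<close> of the
    whole sequence; hence the parameter \<open>t + 1\<close>.\<close>
  have ctl': "norm_inf (xs ! i) < f (i + (t + 1))" if "i < length xs" for i
    using ctl that unfolding controlled_def by (auto dest!: spec[of _ "Suc i"])
  have "set (map ?h xs) \<subseteq> carrier_of (derived_type f \<tau> (fst (fst x)) t)"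
    using residual_map_in_carrier[of x \<tau> f t, OF x] xs by auto
  moreover have "controlled f (t + 1) (map ?h xs)"
    using ctl' norm_inf_residual_map le_less_trans unfolding controlled_def
    by (metis length_map nth_map)
  moreover have "bad (map ?h xs)"
  proof (rule bad_map)
    show "bad xs" using bad by (simp add: bad_Cons_iff)
    show "point_le y z" if "y \<in> set xs" "z \<in> set xs" "point_le (?h y) (?h z)" for y z
      using residual_map_reflects[of x \<tau> f t, OF x] xs that by blast
  qed
  ultimately have "length (map ?h xs) \<in> bad_lengths f (derived_type f \<tau> (fst (fst x)) t) (t + 1)"
    unfolding bad_lengths_def by blast
  moreover have "fst (fst x) \<in># \<tau>"
    using x(1) by (auto simp: carrier_of_def simp flip: count_greater_zero_iff)
  ultimately show thesis
    using that n by simp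
qed

text \<open>One \<open>k\<close> gives way to finitely many copies of the smaller
  \<open>k - 1\<close>, or to nothing when \<open>k = 0\<close>.\<close>

lemma derived_type_mult1:
  assumes "k \<in># \<tau>"
  shows "(derived_type f \<tau> k t, \<tau>) \<in> mult1 less_than"
  unfolding mult1_def derived_type_def
proof (clarify, intro exI conjI allI impI)
  show "\<tau> = add_mset k (\<tau> - {#k#})"
    using assms by simp
next
  fix b
  assume "b \<in># repeat_mset (N f k t) {#k - 1#}"
  then show "(b, k) \<in> less_than"
    by (cases "k = 0") (auto simp: N_def simp flip: count_greater_zero_iff split: if_splits)
qed simp

text \<open>The type descends while the control parameter grows, so the induction is on the type
  with \<open>t\<close> arbitrary. A type has finitely many dimensions, so each step is a finite
  union.\<close>

lemma finite_bad_lengths: "finite (bad_lengths f \<tau> t)"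
  using wf_mult1[OF wf_less_than]
proof (induction \<tau> arbitrary: t rule: wf_induct_rule)
  case (less \<tau>)
  have "bad_lengths f \<tau> t \<subseteq>
      insert 0 (\<Union>k \<in> set_mset \<tau>. Suc ` bad_lengths f (derived_type f \<tau> k t) (t + 1))"
    (is "_ \<subseteq> ?B")
  proof
    fix n
    assume n: "n \<in> bad_lengths f \<tau> t"
    show "n \<in> ?B"
    proof (cases "n = 0")
      case False
      then show ?thesis by (rule bad_lengths_step[OF n]) blast
    qed simp
  qed
  moreover have "finite ?B"
    by (intro finite.insertI finite_UN_I finite_imageI less derived_type_mult1) simp_all
  ultimately show ?case
    by (rule finite_subset)
qed

section \<open>The recursive inequality\<close>

lemma L_eq_Max_bad_lengths: "L f \<tau> t = Max (bad_lengths f \<tau> t)"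
  by (simp add: L_def bad_lengths_def)

lemma bad_lengths_le_L: "n \<in> bad_lengths f \<tau> t \<Longrightarrow> n \<le> L f \<tau> t"
  by (simp add: L_eq_Max_bad_lengths finite_bad_lengths)

text \<open>The empty sequence makes the finite set of lengths nonempty, so its maximum is
  attained.\<close>

lemma L_in_bad_lengths: "L f \<tau> t \<in> bad_lengths f \<tau> t"
proof -
  have "0 \<in> bad_lengths f \<tau> t"
    by (auto simp: bad_lengths_def controlled_def bad_def)
  then show ?thesis
    unfolding L_eq_Max_bad_lengths using finite_bad_lengths by (intro Max_in) auto
qed

theorem theorem1:
  fixes f :: "nat \<Rightarrow> nat" and \<tau> :: "nat multiset" and t :: nat
  assumes "mono f" and "f 0 > 0"
  shows "L f \<tau> t \<le> (if \<tau> = {#} then 0 else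
           Max ((\<lambda>k. 1 + L f (derived_type f \<tau> k t) (t + 1)) ` set_mset \<tau>))"
proof (cases "L f \<tau> t = 0")
  case False
  \<comment> \<open>The step is applied to a sequence of maximal length.\<close>
  from bad_lengths_step[OF L_in_bad_lengths False]
  obtain k n' where k: "k \<in># \<tau>" and n': "n' \<in> bad_lengths f (derived_type f \<tau> k t) (t + 1)"
    and eq: "L f \<tau> t = Suc n'" .
  have "L f \<tau> t \<le> 1 + L f (derived_type f \<tau> k t) (t + 1)"
    using bad_lengths_le_L[OF n'] eq by simp
  also have "\<dots> \<le> Max ((\<lambda>k. 1 + L f (derived_type f \<tau> k t) (t + 1)) ` set_mset \<tau>)"
    using k by (intro Max_ge) auto
  \<comment> \<open>Membership of \<open>k\<close> excludes the empty type, so the conditional takes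
    its second branch.\<close>
  finally show ?thesis
    using k by auto
qed simp

end
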